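(* Let $H$ be a subcone of $\mathscr{V}_N$. Then the signed measures with finite support are sequentially weakly* dense in the dual cone $H^*$; that is, for every $\mu\in H^*$ there is a sequence $(\mu_m)$ of finitely supported signed measures on $S_{N-1}$ belonging to $H^*$ that converges weakly* to $\mu$.
   Context: $S_{N-1}$ is the Euclidean unit sphere of $\mathbb{R}^N$ and $C(S_{N-1})$ is the space of continuous real functions on it; its dual is identified with the regular Borel signed measures on $S_{N-1}$. $\mathscr{V}_N$ is the set of all nonempty compact convex subsets of $\mathbb{R}^N$; a member $\mathfrak{x}$ of it is identified with (the restriction to $S_{N-1}$ of) its support function $\mathfrak{x}(z)=\sup\{(x,z):x\in\mathfrak{x}\}$, so that $\mathscr{V}_N$ is a convex cone in $C(S_{N-1})$ (addition is Minkowski addition). A subcone is a subset closed under addition and multiplication by nonnegative scalars. For a subcone $H$, the dual cone $H^*$ is the set of regular Borel signed measures $\mu$ on $S_{N-1}$ with $\mu(h)=\int_{S_{N-1}}h\,d\mu\ge 0$ for all $h\in H$. Weak* convergence is convergence tested against all of $C(S_{N-1})$. *)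

theory Defs
  imports "HOL-Analysis.Analysis" "HOL-Library.Set_Algebras"
begin

definition convex_bodies :: "(real ^ 'n) set set" where
  "convex_bodies = {K. K \<noteq> {} \<and> compact K \<and> convex K}"

definition support_fun :: "(real ^ 'n) set \<Rightarrow> real ^ 'n \<Rightarrow> real" where
  "support_fun K z = (SUP x\<in>K. x \<bullet> z)"

(* On sets, + is the Minkowski sum of HOL-Library.Set_Algebras.  The correspondence between
   bodies and support functions is injective and carries Minkowski operations to pointwise ones,
   so a subcone may be given as a family of bodies. *)
definition subcone :: "(real ^ 'n) set set \<Rightarrow> bool" where
  "subcone H \<longleftrightarrow> H \<subseteq> convex_bodies \<and>
     (\<forall>K\<in>H. \<forall>L\<in>H. K + L \<in> H) \<and>
     (\<forall>K\<in>H. \<forall>c\<ge>0. (\<lambda>x. c *\<^sub>R x) ` K \<in> H)"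

definition sphere_borel :: "(real ^ 'n) measure" where
  "sphere_borel = restrict_space borel (sphere 0 1)"

(* A finite signed measure is a real-valued countably additive set function on the sigma-algebra
   of M, extended by 0 to the non-measurable sets. *)
definition signed_measure :: "'a measure \<Rightarrow> ('a set \<Rightarrow> real) \<Rightarrow> bool" where
  "signed_measure M \<mu> \<longleftrightarrow> \<mu> {} = 0 \<and>
     (\<forall>A :: nat \<Rightarrow> 'a set. range A \<subseteq> sets M \<longrightarrow> disjoint_family A \<longrightarrow>
        (\<lambda>i. \<mu> (A i)) sums \<mu> (\<Union>i. A i)) \<and>
     (\<forall>A. A \<notin> sets M \<longrightarrow> \<mu> A = 0)"

(* Positive part of the Jordan decomposition; the negative part is the upper variation of -\<mu>. *)
definition upper_variation :: "'a measure \<Rightarrow> ('a set \<Rightarrow> real) \<Rightarrow> 'a measure" where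
  "upper_variation M \<mu> = measure_of (space M) (sets M)
     (\<lambda>A. SUP B\<in>{B \<in> sets M. B \<subseteq> A}. ennreal (\<mu> B))"

definition signed_integral :: "'a measure \<Rightarrow> ('a set \<Rightarrow> real) \<Rightarrow> ('a \<Rightarrow> real) \<Rightarrow> real" where
  "signed_integral M \<mu> f =
     integral\<^sup>L (upper_variation M \<mu>) f - integral\<^sup>L (upper_variation M (\<lambda>A. - \<mu> A)) f"

(* Regularity in the form of Dunford and Schwartz: smallness of \<mu> on every measurable subset
   of U - F is smallness of the total variation of U - F. *)
definition regular_signed_measure :: "((real ^ 'n) set \<Rightarrow> real) \<Rightarrow> bool" where
  "regular_signed_measure \<mu> \<longleftrightarrow> signed_measure sphere_borel \<mu> \<and>
     (\<forall>A\<in>sets sphere_borel. \<forall>e>0. \<exists>F U.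
        closedin (top_of_set (sphere 0 1)) F \<and> openin (top_of_set (sphere 0 1)) U \<and>
        F \<subseteq> A \<and> A \<subseteq> U \<and>
        (\<forall>B\<in>sets sphere_borel. B \<subseteq> U - F \<longrightarrow> \<bar>\<mu> B\<bar> < e))"

(* The points all of whose open neighbourhoods have nonzero total variation. *)
definition measure_support :: "((real ^ 'n) set \<Rightarrow> real) \<Rightarrow> (real ^ 'n) set" where
  "measure_support \<mu> = {x \<in> sphere 0 1. \<forall>U. openin (top_of_set (sphere 0 1)) U \<longrightarrow> x \<in> U \<longrightarrow>
     (\<exists>B\<in>sets sphere_borel. B \<subseteq> U \<and> \<mu> B \<noteq> 0)}"

definition dual_cone :: "(real ^ 'n) set set \<Rightarrow> ((real ^ 'n) set \<Rightarrow> real) set" where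
  "dual_cone H = {\<mu>. regular_signed_measure \<mu> \<and>
     (\<forall>K\<in>H. signed_integral sphere_borel \<mu> (support_fun K) \<ge> 0)}"

definition weak_star_converges ::
  "(nat \<Rightarrow> (real ^ 'n) set \<Rightarrow> real) \<Rightarrow> ((real ^ 'n) set \<Rightarrow> real) \<Rightarrow> bool" where
  "weak_star_converges \<nu> \<mu> \<longleftrightarrow> (\<forall>f :: real ^ 'n \<Rightarrow> real. continuous_on (sphere 0 1) f \<longrightarrow>
     (\<lambda>m. signed_integral sphere_borel (\<nu> m) f) \<longlonglongrightarrow> signed_integral sphere_borel \<mu> f)"

end

theory Submission
  imports Defs
begin

text \<open>Let \<open>\<mu> = U - V\<close> be the Jordan decomposition. Take weight functions \<open>w\<^sub>k\<close> on the sphere that form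
  a partition of unity subordinate to small balls around nodes \<open>q\<^sub>k\<close> and satisfy
  \<open>\<Sum> w\<^sub>k(z) q\<^sub>k = z\<close>. Replace \<open>U\<close> by masses in the directions of the vectors \<open>(\<integral> w\<^sub>k dU) q\<^sub>k\<close>, and \<open>V\<close>
  by masses in the directions of \<open>\<integral> w\<^sub>k(z) z dV\<close>, a vector \<open>v\<close> carrying the mass \<open>|v|\<close>. Support functions
  are sublinear, so the first step can only increase their integrals and the second, by Jensen, can
  only decrease them. Hence the discrete signed measure dominates \<open>\<mu>\<close> on every support function and
  stays in the dual cone; uniform continuity gives weak* convergence as the balls shrink.\<close>

subsection \<open>Jordan decomposition\<close>

lemma signed_measure_empty: "signed_measure M \<mu> \<Longrightarrow> \<mu> {} = 0"
  by (simp add: signed_measure_def)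

lemma signed_measure_sums:
  assumes "signed_measure M \<mu>" "range A \<subseteq> sets M" "disjoint_family A"
  shows "(\<lambda>i. \<mu> (A i)) sums \<mu> (\<Union>i. A i)"
  using assms by (simp add: signed_measure_def)

lemma signed_measure_Un:
  assumes "signed_measure M \<mu>" "A \<in> sets M" "B \<in> sets M" "A \<inter> B = {}"
  shows "\<mu> (A \<union> B) = \<mu> A + \<mu> B"
proof -
  have "disjoint_family (binaryset A B)"
    using assms(4) by (auto simp: disjoint_family_on_def binaryset_def)
  moreover have "range (binaryset A B) \<subseteq> sets M"
    using assms by (simp add: range_binaryset_eq)
  ultimately have "(\<lambda>i. \<mu> (binaryset A B i)) sums \<mu> (\<Union>i. binaryset A B i)"
    by (intro signed_measure_sums[OF assms(1)])
  moreover have "(\<lambda>i. \<mu> (binaryset A B i)) sums (\<mu> A + \<mu> B)"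
    by (intro binaryset_sums signed_measure_empty[OF assms(1)])
  ultimately show ?thesis
    using sums_unique2 UN_binaryset_eq by metis
qed

lemma signed_measure_Diff:
  assumes "signed_measure M \<mu>" "A \<in> sets M" "B \<in> sets M" "B \<subseteq> A"
  shows "\<mu> (A - B) = \<mu> A - \<mu> B"
  using signed_measure_Un[OF assms(1), of B "A - B"] assms by (simp add: Un_absorb1)

lemma signed_measure_uminus:
  assumes "signed_measure M \<mu>"
  shows "signed_measure M (\<lambda>A. - \<mu> A)"
  using assms unfolding signed_measure_def by (auto intro: sums_minus)

text \<open>If \<open>\<mu>\<close> were unbounded, one could repeatedly discard a piece of absolute
  mass at least 1 from a set on which it is still unbounded. The discarded pieces are disjoint, so
  by countable additivity their masses form a convergent series, which is impossible.\<close>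

lemma signed_measure_bounded:
  assumes \<mu>: "signed_measure M \<mu>"
  shows "\<exists>C. \<forall>A\<in>sets M. \<bar>\<mu> A\<bar> \<le> C"
proof (rule ccontr)
  assume neg: "\<not> ?thesis"
  define unb where
    "unb A \<longleftrightarrow> A \<in> sets M \<and> (\<forall>C. \<exists>B\<in>sets M. B \<subseteq> A \<and> C < \<bar>\<mu> B\<bar>)" for A
  have split: "\<exists>B. unb B \<and> B \<subseteq> A \<and> 1 \<le> \<bar>\<mu> (A - B)\<bar>" if A: "unb A" for A
  proof -
    \<comment> \<open>The threshold gives both \<open>B\<close> and \<open>A - B\<close> absolute
      mass at least 1, so either half may be the discarded one; the bounds on two bounded halves
      would add up to a bound on \<open>A\<close>.\<close>
    obtain B where B: "B \<in> sets M" "B \<subseteq> A" "1 + \<bar>\<mu> A\<bar> < \<bar>\<mu> B\<bar>"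
      using A unfolding unb_def by blast
    have AM: "A \<in> sets M" using A by (simp add: unb_def)
    have d: "\<mu> (A - B) = \<mu> A - \<mu> B"
      by (rule signed_measure_Diff[OF \<mu> AM B(1,2)])
    have "unb B \<or> unb (A - B)"
    proof (rule ccontr)
      assume "\<not> ?thesis"
      then obtain C1 C2 where C: "\<And>E. E \<in> sets M \<Longrightarrow> E \<subseteq> B \<Longrightarrow> \<bar>\<mu> E\<bar> \<le> C1"
        "\<And>E. E \<in> sets M \<Longrightarrow> E \<subseteq> A - B \<Longrightarrow> \<bar>\<mu> E\<bar> \<le> C2"
        using AM B(1) unfolding unb_def by (metis not_le sets.Diff)
      obtain E where E: "E \<in> sets M" "E \<subseteq> A" "C1 + C2 < \<bar>\<mu> E\<bar>"
        using A unfolding unb_def by blast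
      have "\<mu> (E - E \<inter> B) = \<mu> E - \<mu> (E \<inter> B)"
        by (rule signed_measure_Diff[OF \<mu>]) (use E B in auto)
      moreover have "\<bar>\<mu> (E \<inter> B)\<bar> \<le> C1" "\<bar>\<mu> (E - E \<inter> B)\<bar> \<le> C2"
        using E B by (auto intro!: C)
      ultimately show False using E(3) by linarith
    qed
    then show ?thesis
    proof
      assume "unb B"
      then show ?thesis using B d by (intro exI[of _ B]) auto
    next
      assume "unb (A - B)"
      moreover have "A - (A - B) = B" using B by auto
      ultimately show ?thesis using B by (intro exI[of _ "A - B"]) auto
    qed
  qed
  have "unb (space M)"
    using neg unfolding unb_def by (metis not_le sets.sets_into_space sets.top)
  then obtain A where A: "\<And>n::nat. unb (A n)" "\<And>n. A (Suc n) \<subseteq> A n"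
      "\<And>n. 1 \<le> \<bar>\<mu> (A n - A (Suc n))\<bar>"
    using dependent_nat_choice[of "\<lambda>_. unb" "\<lambda>_ A B. B \<subseteq> A \<and> 1 \<le> \<bar>\<mu> (A - B)\<bar>"] split
    by metis
  \<comment> \<open>\<open>disjoint_family_Suc\<close> is stated for increasing sequences, hence the
    complements.\<close>
  have "disjoint_family (\<lambda>n. - A (Suc n) - - A n)"
    using A(2) by (intro disjoint_family_Suc) auto
  then have "disjoint_family (\<lambda>n. A n - A (Suc n))"
    by (simp add: Diff_eq Int_commute)
  moreover have "range (\<lambda>n. A n - A (Suc n)) \<subseteq> sets M"
    using A(1) by (auto simp: unb_def)
  ultimately have "summable (\<lambda>n. \<mu> (A n - A (Suc n)))"
    using signed_measure_sums[OF \<mu>] sums_summable by blast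
  then have "(\<lambda>n. \<mu> (A n - A (Suc n))) \<longlonglongrightarrow> 0"
    by (rule summable_LIMSEQ_zero)
  then have "(\<lambda>n. \<bar>\<mu> (A n - A (Suc n))\<bar>) \<longlonglongrightarrow> 0"
    by (rule tendsto_rabs_zero)
  then have "1 \<le> (0::real)"
    by (rule LIMSEQ_le_const) (use A(3) in auto)
  then show False by simp
qed

lemma sets_upper_variation [simp]: "sets (upper_variation M \<mu>) = sets M"
  by (simp add: upper_variation_def)

lemma space_upper_variation [simp]: "space (upper_variation M \<mu>) = space M"
  by (simp add: upper_variation_def)

text \<open>The supremum has to be shown countably additive before \<open>measure_of\<close> returns
  it. It is monotone and superadditive on disjoint sets, which bounds the series from above;
  conversely, each \<open>\<mu> B\<close> is a limit of partial sums over the pieces of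
  \<open>B\<close>, which bounds the supremum by the series.\<close>

lemma emeasure_upper_variation:
  assumes \<mu>: "signed_measure M \<mu>" and A: "A \<in> sets M"
  shows "emeasure (upper_variation M \<mu>) A = (SUP B\<in>{B \<in> sets M. B \<subseteq> A}. ennreal (\<mu> B))"
proof -
  define u where "u A = (SUP B\<in>{B \<in> sets M. B \<subseteq> A}. ennreal (\<mu> B))" for A
  note empty = signed_measure_empty[OF \<mu>]
  have u_upper: "ennreal (\<mu> B) \<le> u A" if "B \<in> sets M" "B \<subseteq> A" for A B
    unfolding u_def using that by (intro SUP_upper) auto
  have u_mono: "u A \<le> u B" if "A \<subseteq> B" for A B
    unfolding u_def using that by (intro SUP_subset_mono) auto
  have u_super: "u A + u B \<le> u (A \<union> B)" if "A \<inter> B = {}" for A B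
  proof -
    have "ennreal (\<mu> E) + ennreal (\<mu> F) \<le> u (A \<union> B)"
      if "E \<in> sets M" "E \<subseteq> A" "F \<in> sets M" "F \<subseteq> B" for E F
    proof -
      \<comment> \<open>\<open>ennreal\<close> cuts negative values to 0. Replacing a set of
        negative mass by the empty set has the same effect and restores additivity.\<close>
      define E' F' where "E' = (if \<mu> E \<ge> 0 then E else {})" "F' = (if \<mu> F \<ge> 0 then F else {})"
      have *: "E' \<in> sets M" "F' \<in> sets M" "E' \<subseteq> A" "F' \<subseteq> B" "\<mu> E' \<ge> 0" "\<mu> F' \<ge> 0"
        "ennreal (\<mu> E) = ennreal (\<mu> E')" "ennreal (\<mu> F) = ennreal (\<mu> F')"
        using that empty by (auto simp: E'_F'_def ennreal_neg)
      have "ennreal (\<mu> E) + ennreal (\<mu> F) = ennreal (\<mu> (E' \<union> F'))"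
        using * \<open>A \<inter> B = {}\<close> by (subst signed_measure_Un[OF \<mu>]) (auto simp: ennreal_plus)
      also have "\<dots> \<le> u (A \<union> B)"
        using * by (intro u_upper) auto
      finally show ?thesis .
    qed
    then have "ennreal (\<mu> E) + u B \<le> u (A \<union> B)" if "E \<in> sets M" "E \<subseteq> A" for E
      using that unfolding u_def[of B]
      by (subst ennreal_SUP_add_right) (auto intro!: SUP_least)
    then show ?thesis
      unfolding u_def[of A]
      by (subst ennreal_SUP_add_left[symmetric]) (auto intro!: SUP_least)
  qed
  have "countably_additive (sets M) u"
    unfolding countably_additive_def
  proof (intro allI impI antisym)
    fix A :: "nat \<Rightarrow> _" assume A: "range A \<subseteq> sets M" "disjoint_family A" "\<Union> (range A) \<in> sets M"
    have "(\<Sum>i<n. u (A i)) \<le> u (\<Union>i<n. A i)" for n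
    proof (induction n)
      case (Suc n)
      have "A i \<inter> A n = {}" if "i < n" for i
        using disjoint_family_onD[OF A(2), of i n] that by simp
      then have "(\<Union>i<n. A i) \<inter> A n = {}" by blast
      then have "u (\<Union>i<n. A i) + u (A n) \<le> u (\<Union>i<Suc n. A i)"
        using u_super[of "\<Union>i<n. A i" "A n"] by (simp add: lessThan_Suc Un_commute)
      then show ?case using Suc by (auto intro: add_right_mono order_trans)
    qed simp
    moreover have "u (\<Union>i<n. A i) \<le> u (\<Union> (range A))" for n
      by (intro u_mono) auto
    ultimately show "(\<Sum>i. u (A i)) \<le> u (\<Union> (range A))"
      using order_trans by (intro suminf_le_const) blast+
    show "u (\<Union> (range A)) \<le> (\<Sum>i. u (A i))"
      unfolding u_def[of "\<Union> (range A)"]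
    proof (intro SUP_least)
      fix B assume B: "B \<in> {B \<in> sets M. B \<subseteq> \<Union> (range A)}"
      have "(\<lambda>i. \<mu> (B \<inter> A i)) sums \<mu> (\<Union>i. B \<inter> A i)"
        using A B by (intro signed_measure_sums[OF \<mu>]) (auto simp: disjoint_family_on_def)
      moreover have "(\<Union>i. B \<inter> A i) = B" using B by auto
      ultimately have "(\<lambda>n. ennreal (\<Sum>i<n. \<mu> (B \<inter> A i))) \<longlonglongrightarrow> ennreal (\<mu> B)"
        by (intro tendsto_ennrealI) (simp add: sums_def)
      moreover have "ennreal (\<Sum>i<n. \<mu> (B \<inter> A i)) \<le> (\<Sum>i. u (A i))" for n
      proof -
        have "ennreal (\<Sum>i<n. \<mu> (B \<inter> A i)) \<le> (\<Sum>i<n. u (A i))"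
        proof (induction n)
          case (Suc n)
          \<comment> \<open>Only an inequality holds here, because cutting negative values to 0 is
            subadditive.\<close>
          have "ennreal (\<Sum>i<Suc n. \<mu> (B \<inter> A i))
              \<le> ennreal (\<Sum>i<n. \<mu> (B \<inter> A i)) + ennreal (\<mu> (B \<inter> A n))"
            by (simp add: ennreal_plus_if ennreal_leI)
          also have "\<dots> \<le> (\<Sum>i<n. u (A i)) + u (A n)"
            using A B Suc by (intro add_mono u_upper) auto
          finally show ?case by simp
        qed simp
        also have "\<dots> \<le> (\<Sum>i. u (A i))" by (intro sum_le_suminf) auto
        finally show ?thesis .
      qed
      ultimately show "ennreal (\<mu> B) \<le> (\<Sum>i. u (A i))"
        by (intro LIMSEQ_le_const2) auto
    qed
  qed
  moreover have "u {} = 0" by (auto simp: u_def empty SUP_constant intro!: antisym SUP_least)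
  then have "positive (sets M) u" by (simp add: positive_def)
  ultimately show ?thesis
    using A by (subst emeasure_measure_of[OF upper_variation_def])
      (auto simp: u_def[abs_def] sets.space_closed)
qed

lemma finite_measure_upper_variation:
  assumes "signed_measure M \<mu>"
  shows "finite_measure (upper_variation M \<mu>)"
proof
  obtain C where C: "\<forall>A\<in>sets M. \<bar>\<mu> A\<bar> \<le> C"
    using signed_measure_bounded[OF assms] by blast
  have "emeasure (upper_variation M \<mu>) (space M) \<le> ennreal C"
    unfolding emeasure_upper_variation[OF assms sets.top]
  proof (intro SUP_least ennreal_leI)
    fix B assume "B \<in> {B \<in> sets M. B \<subseteq> space M}"
    then have "\<bar>\<mu> B\<bar> \<le> C" using C by simp
    then show "\<mu> B \<le> C" by simp
  qed
  then show "emeasure (upper_variation M \<mu>) (space (upper_variation M \<mu>)) \<noteq> \<infinity>"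
    by (auto simp: top_unique)
qed

text \<open>For \<open>B \<subseteq> A\<close>, \<open>\<mu> B\<close> equals
  \<open>\<mu> A - \<mu> (A - B)\<close>, which is at most \<open>\<mu> A\<close> plus the negative
  variation of \<open>A\<close>. The supremum over \<open>B\<close> gives one inequality, and the
  same argument for \<open>- \<mu>\<close> gives the other.\<close>

lemma signed_measure_eq_upper_variation_diff:
  assumes \<mu>: "signed_measure M \<mu>" and A: "A \<in> sets M"
  shows "\<mu> A = measure (upper_variation M \<mu>) A - measure (upper_variation M (\<lambda>A. - \<mu> A)) A"
proof -
  have *: "measure (upper_variation M \<nu>) A
      \<le> \<nu> A + measure (upper_variation M (\<lambda>A. - \<nu> A)) A"
    if \<nu>: "signed_measure M \<nu>" for \<nu>
  proof -
    interpret U: finite_measure "upper_variation M \<nu>"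
      by (rule finite_measure_upper_variation[OF \<nu>])
    interpret V: finite_measure "upper_variation M (\<lambda>A. - \<nu> A)"
      by (rule finite_measure_upper_variation[OF signed_measure_uminus[OF \<nu>]])
    let ?v = "measure (upper_variation M (\<lambda>A. - \<nu> A)) A"
    have le: "\<nu> B \<le> \<nu> A + ?v" if B: "B \<in> sets M" "B \<subseteq> A" for B
    proof -
      have "ennreal (- \<nu> (A - B)) \<le> emeasure (upper_variation M (\<lambda>A. - \<nu> A)) A"
        unfolding emeasure_upper_variation[OF signed_measure_uminus[OF \<nu>] A]
        using A B by (intro SUP_upper) auto
      then have "- \<nu> (A - B) \<le> ?v"
        by (simp add: V.emeasure_eq_measure)
      then show ?thesis
        using signed_measure_Diff[OF \<nu> A B] by simp
    qed
    have "emeasure (upper_variation M \<nu>) A \<le> ennreal (\<nu> A + ?v)"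
      unfolding emeasure_upper_variation[OF \<nu> A]
      using le by (intro SUP_least ennreal_leI) auto
    \<comment> \<open>Without this sign the bound in \<open>ennreal\<close> would not transfer to
      the reals.\<close>
    moreover have "0 \<le> \<nu> A + ?v"
      using le[of "{}"] signed_measure_empty[OF \<nu>] by simp
    ultimately show ?thesis
      by (simp add: U.emeasure_eq_measure)
  qed
  show ?thesis
    using *[OF \<mu>] *[OF signed_measure_uminus[OF \<mu>]] by simp
qed

section \<open>Independence of the signed integral from the chosen decomposition\<close>

text \<open>An equality of differences of measures is stated with sums on both sides, since
  subtraction is badly behaved in \<open>ennreal\<close>. Sums survive every step of the induction
  over nonnegative measurable functions, including monotone suprema.\<close>

lemma nn_integral_add_eq_add:
  assumes [measurable_cong]: "sets Q = sets P" "sets R = sets P" "sets S = sets P"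
    and eq: "\<And>A. A \<in> sets P \<Longrightarrow> emeasure P A + emeasure Q A = emeasure R A + emeasure S A"
    and f: "f \<in> borel_measurable P"
  shows "(\<integral>\<^sup>+x. f x \<partial>P) + (\<integral>\<^sup>+x. f x \<partial>Q) = (\<integral>\<^sup>+x. f x \<partial>R) + (\<integral>\<^sup>+x. f x \<partial>S)"
  using f
proof (induction rule: borel_measurable_induct)
  case (cong f g)
  have "(\<integral>\<^sup>+x. f x \<partial>N) = (\<integral>\<^sup>+x. g x \<partial>N)" if "sets N = sets P" for N
    using cong(3) sets_eq_imp_space_eq[OF that] by (intro nn_integral_cong) simp
  then show ?case using cong(4) assms(1-3) by simp
next
  case (set A)
  then show ?case using eq by (simp add: assms)
next
  case (mult f c)
  then show ?case
    by (simp add: nn_integral_cmult distrib_left[symmetric])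
next
  case (add f g)
  have "(\<integral>\<^sup>+x. f x + g x \<partial>N) = (\<integral>\<^sup>+x. f x \<partial>N) + (\<integral>\<^sup>+x. g x \<partial>N)"
    if [measurable_cong]: "sets N = sets P" for N
    using add by (intro nn_integral_add) simp_all
  then show ?case using add assms by (simp add: ac_simps)
next
  case (seq F)
  have m: "F i \<in> borel_measurable N" if "sets N = sets P" for N i
    using seq(1) measurable_cong_sets[OF that refl] by blast
  have "(\<integral>\<^sup>+x. (SUP i. F i) x \<partial>N) = (SUP i. \<integral>\<^sup>+x. F i x \<partial>N)" if "sets N = sets P" for N
    using nn_integral_monotone_convergence_SUP[OF \<open>incseq F\<close> m[OF that]] by (simp add: image_comp)
  moreover have "(SUP i. \<integral>\<^sup>+x. F i x \<partial>N) + (SUP i. \<integral>\<^sup>+x. F i x \<partial>N')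
      = (SUP i. (\<integral>\<^sup>+x. F i x \<partial>N) + (\<integral>\<^sup>+x. F i x \<partial>N'))" for N N'
    using \<open>incseq F\<close>
    by (intro ennreal_SUP_add[symmetric]) (auto simp: incseq_def le_fun_def intro!: nn_integral_mono)
  ultimately show ?case using seq assms by simp
qed

lemma integral_add_eq_add:
  fixes f :: "'a \<Rightarrow> real"
  assumes "sets Q = sets P" "sets R = sets P" "sets S = sets P"
    and "\<And>A. A \<in> sets P \<Longrightarrow> emeasure P A + emeasure Q A = emeasure R A + emeasure S A"
    and "integrable P f" "integrable Q f" "integrable R f" "integrable S f"
  shows "integral\<^sup>L P f + integral\<^sup>L Q f = integral\<^sup>L R f + integral\<^sup>L S f"
proof -
  have "f \<in> borel_measurable P" using assms(5) by simp
  then have eqs: "(\<integral>\<^sup>+x. ennreal (f x) \<partial>P) + (\<integral>\<^sup>+x. ennreal (f x) \<partial>Q)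
      = (\<integral>\<^sup>+x. ennreal (f x) \<partial>R) + (\<integral>\<^sup>+x. ennreal (f x) \<partial>S)"
    "(\<integral>\<^sup>+x. ennreal (- f x) \<partial>P) + (\<integral>\<^sup>+x. ennreal (- f x) \<partial>Q)
      = (\<integral>\<^sup>+x. ennreal (- f x) \<partial>R) + (\<integral>\<^sup>+x. ennreal (- f x) \<partial>S)"
    by (intro nn_integral_add_eq_add assms(1-4); simp)+
  \<comment> \<open>Reversing the rule merges each side into a single \<open>ennreal\<close> of a
    nonnegative real, so the two equations can be read off in the reals.\<close>
  note ennreal_plus[symmetric, simp] ennreal_plus[simp del]
  obtain p p' where "0 \<le> p" "0 \<le> p'" "(\<integral>\<^sup>+x. ennreal (f x) \<partial>P) = ennreal p"
    "(\<integral>\<^sup>+x. ennreal (- f x) \<partial>P) = ennreal p'" "integral\<^sup>L P f = p - p'"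
    using integrableE[OF assms(5)] by metis
  moreover obtain q q' where "0 \<le> q" "0 \<le> q'" "(\<integral>\<^sup>+x. ennreal (f x) \<partial>Q) = ennreal q"
    "(\<integral>\<^sup>+x. ennreal (- f x) \<partial>Q) = ennreal q'" "integral\<^sup>L Q f = q - q'"
    using integrableE[OF assms(6)] by metis
  moreover obtain r r' where "0 \<le> r" "0 \<le> r'" "(\<integral>\<^sup>+x. ennreal (f x) \<partial>R) = ennreal r"
    "(\<integral>\<^sup>+x. ennreal (- f x) \<partial>R) = ennreal r'" "integral\<^sup>L R f = r - r'"
    using integrableE[OF assms(7)] by metis
  moreover obtain s s' where "0 \<le> s" "0 \<le> s'" "(\<integral>\<^sup>+x. ennreal (f x) \<partial>S) = ennreal s"
    "(\<integral>\<^sup>+x. ennreal (- f x) \<partial>S) = ennreal s'" "integral\<^sup>L S f = s - s'"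
    using integrableE[OF assms(8)] by metis
  ultimately show ?thesis using eqs by simp
qed

lemma signed_measure_measure_diff:
  assumes P: "finite_measure P" "sets P = sets M" and Q: "finite_measure Q" "sets Q = sets M"
  shows "signed_measure M (\<lambda>A. measure P A - measure Q A)"
  unfolding signed_measure_def
proof (intro conjI allI impI)
  fix A :: "nat \<Rightarrow> _" assume "range A \<subseteq> sets M" "disjoint_family A"
  then show "(\<lambda>i. measure P (A i) - measure Q (A i)) sums
      (measure P (\<Union> (range A)) - measure Q (\<Union> (range A)))"
    using P Q by (intro sums_diff finite_measure.finite_measure_UNION) auto
qed (use P Q in \<open>auto simp: measure_notin_sets\<close>)

text \<open>The pair \<open>P\<close>, \<open>Q\<close> may have common mass and need not be the
  Jordan decomposition \<open>U\<close>, \<open>V\<close>. Both pairs have the same difference, so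
  \<open>U + Q = V + P\<close> as measures. Thus the Jordan decomposition of a discrete signed
  measure never has to be computed.\<close>

lemma signed_integral_measure_diff:
  assumes P: "finite_measure P" "sets P = sets M" and Q: "finite_measure Q" "sets Q = sets M"
    and f: "f \<in> borel_measurable M" "\<And>x. x \<in> space M \<Longrightarrow> \<bar>f x\<bar> \<le> C"
  shows "signed_integral M (\<lambda>A. measure P A - measure Q A) f = integral\<^sup>L P f - integral\<^sup>L Q f"
proof -
  define \<mu> where "\<mu> = (\<lambda>A. measure P A - measure Q A)"
  have \<mu>: "signed_measure M \<mu>"
    unfolding \<mu>_def by (rule signed_measure_measure_diff[OF P Q])
  define U V where "U = upper_variation M \<mu>" "V = upper_variation M (\<lambda>A. - \<mu> A)"
  have U: "finite_measure U" "sets U = sets M" and V: "finite_measure V" "sets V = sets M"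
    unfolding U_V_def
    by (simp_all add: finite_measure_upper_variation \<mu> signed_measure_uminus)
  have int: "integrable N f" if N: "finite_measure N" "sets N = sets M" for N
  proof (rule finite_measure.integrable_const_bound[OF N(1)])
    show "AE x in N. norm (f x) \<le> C"
      using f(2) sets_eq_imp_space_eq[OF N(2)] by (intro AE_I2) simp
    show "f \<in> borel_measurable N" using f(1) measurable_cong_sets[OF N(2) refl] by blast
  qed
  have "integral\<^sup>L U f + integral\<^sup>L Q f = integral\<^sup>L V f + integral\<^sup>L P f"
  proof (intro integral_add_eq_add int U V P Q)
    fix A assume "A \<in> sets U"
    then have "\<mu> A = measure U A - measure V A"
      unfolding U_V_def by (intro signed_measure_eq_upper_variation_diff[OF \<mu>]) simp
    then have "measure U A + measure Q A = measure V A + measure P A"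
      by (simp add: \<mu>_def)
    then show "emeasure U A + emeasure Q A = emeasure V A + emeasure P A"
      by (simp add: finite_measure.emeasure_eq_measure U V P Q ennreal_plus[symmetric] del: ennreal_plus)
  qed (simp_all add: U V P Q)
  then show ?thesis
    by (simp add: signed_integral_def U_V_def \<mu>_def[symmetric])
qed

subsection \<open>Support functions\<close>

lemma inner_le_support_fun:
  assumes "K \<in> convex_bodies" "x \<in> K"
  shows "x \<bullet> z \<le> support_fun K z"
proof -
  have "bdd_above ((\<lambda>x. x \<bullet> z) ` K)"
    using assms by (intro bounded_imp_bdd_above compact_imp_bounded compact_continuous_image)
      (auto simp: convex_bodies_def intro!: continuous_intros)
  then show ?thesis
    unfolding support_fun_def using assms(2) by (intro cSUP_upper) auto
qed

lemma support_fun_le: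
  assumes "K \<in> convex_bodies" "\<And>x. x \<in> K \<Longrightarrow> x \<bullet> z \<le> c"
  shows "support_fun K z \<le> c"
  unfolding support_fun_def using assms by (intro cSUP_least) (auto simp: convex_bodies_def)

text \<open>The upper bound for the factor \<open>c\<close>, together with the one for
  \<open>1 / c\<close>, gives equality. At \<open>c = 0\<close> a point of the nonempty
  \<open>K\<close> supplies the lower bound.\<close>

lemma support_fun_scaleR:
  assumes K: "K \<in> convex_bodies" and "0 \<le> c"
  shows "support_fun K (c *\<^sub>R z) = c * support_fun K z"
proof -
  have le: "support_fun K (a *\<^sub>R y) \<le> a * support_fun K y" if "0 \<le> a" for a y
    using that by (intro support_fun_le[OF K]) (simp add: inner_le_support_fun[OF K] mult_left_mono)
  show ?thesis
  proof (cases "c = 0")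
    case True
    obtain x where "x \<in> K" using K by (auto simp: convex_bodies_def)
    then show ?thesis
      using True le[of 0 z] inner_le_support_fun[OF K, of x "0 *\<^sub>R z"] by simp
  next
    case False
    then show ?thesis
      using le[of c z] le[of "1 / c" "c *\<^sub>R z"] \<open>0 \<le> c\<close> by (simp add: field_simps)
  qed
qed

lemma support_fun_sum_le:
  assumes K: "K \<in> convex_bodies" and "\<And>i. i \<in> I \<Longrightarrow> 0 \<le> c i"
  shows "support_fun K (\<Sum>i\<in>I. c i *\<^sub>R z i) \<le> (\<Sum>i\<in>I. c i * support_fun K (z i))"
  using assms(2)
  by (intro support_fun_le[OF K])
    (auto simp: inner_sum_right intro!: sum_mono mult_left_mono inner_le_support_fun[OF K])

text \<open>A finite convex function on a finite-dimensional space is continuous.\<close>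

lemma continuous_on_support_fun:
  assumes K: "K \<in> convex_bodies"
  shows "continuous_on S (support_fun K)"
proof -
  have "convex_on UNIV (support_fun K)"
  proof (rule convex_onI)
    fix t x y assume t: "0 < t" "t < (1::real)"
    \<comment> \<open>The convex combination is written as a sum over the two truth values so that
      \<open>support_fun_sum_le\<close> applies.\<close>
    have "support_fun K ((1 - t) *\<^sub>R x + t *\<^sub>R y)
        = support_fun K (\<Sum>i\<in>{False, True}. (if i then t else 1 - t) *\<^sub>R (if i then y else x))"
      by simp
    also have "\<dots> \<le> (1 - t) * support_fun K x + t * support_fun K y"
      using t by (intro order_trans[OF support_fun_sum_le[OF K]]) auto
    finally show "support_fun K ((1 - t) *\<^sub>R x + t *\<^sub>R y)
        \<le> (1 - t) * support_fun K x + t * support_fun K y" .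
  qed simp
  then have "continuous_on UNIV (support_fun K)"
    by (intro convex_on_continuous) auto
  then show ?thesis by (rule continuous_on_subset) simp
qed

subsection \<open>Finitely supported measures on the sphere\<close>

lemma space_sphere_borel [simp]: "space sphere_borel = sphere 0 1"
  by (simp add: sphere_borel_def space_restrict_space)

lemma sphere_borel_measurable [measurable]:
  "continuous_on (sphere 0 1) f \<Longrightarrow> f \<in> borel_measurable sphere_borel"
  unfolding sphere_borel_def by (rule borel_measurable_continuous_on_restrict)

lemma continuous_on_sphere_bounded:
  fixes f :: "real ^ 'n \<Rightarrow> 'b::real_normed_vector"
  assumes "continuous_on (sphere 0 1) f"
  shows "\<exists>C. \<forall>x\<in>sphere 0 1. norm (f x) \<le> C"
  using compact_imp_bounded[OF compact_continuous_image[OF assms compact_sphere]]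
  by (simp add: bounded_iff)

lemma integrable_continuous_on_sphere:
  fixes f :: "real ^ 'n \<Rightarrow> 'b::{banach, second_countable_topology}"
  assumes M: "finite_measure M" "sets M = sets sphere_borel" and f: "continuous_on (sphere 0 1) f"
  shows "integrable M f"
proof -
  obtain C where "\<forall>x\<in>sphere 0 1. norm (f x) \<le> C"
    using continuous_on_sphere_bounded[OF f] by blast
  then show ?thesis
    using M sphere_borel_measurable[OF f] sets_eq_imp_space_eq[OF M(2)]
    by (intro finite_measure.integrable_const_bound[OF M(1)])
      (auto cong: measurable_cong_sets)
qed

lemma signed_integral_continuous:
  fixes f :: "real ^ 'n \<Rightarrow> real"
  assumes "finite_measure P" "sets P = sets sphere_borel"
    and "finite_measure Q" "sets Q = sets sphere_borel" and f: "continuous_on (sphere 0 1) f"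
  shows "signed_integral sphere_borel (\<lambda>A. measure P A - measure Q A) f
    = integral\<^sup>L P f - integral\<^sup>L Q f"
proof -
  obtain C where "\<forall>x\<in>sphere 0 1. norm (f x) \<le> C"
    using continuous_on_sphere_bounded[OF f] by blast
  then show ?thesis
    by (intro signed_integral_measure_diff[where C = C] assms sphere_borel_measurable f) simp
qed

section \<open>Homogeneous extensions and point masses in prescribed directions\<close>

text \<open>The direction of 0 is an arbitrary unit vector, so that point masses of weight 0 still sit on
  the sphere.\<close>

definition unit_dir :: "'a::euclidean_space \<Rightarrow> 'a" where
  "unit_dir v = (if v = 0 then SOME b. b \<in> Basis else sgn v)"

lemma norm_unit_dir [simp]: "norm (unit_dir v) = 1"
  by (simp add: unit_dir_def norm_sgn SOME_Basis)

text \<open>The positively homogeneous extension of degree one from the sphere to the whole space.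
  Its value at \<open>v\<close> is the integral of \<open>f\<close> against a point mass of weight
  \<open>norm v\<close> in the direction of \<open>v\<close>; at 0 it vanishes whatever direction is
  assigned there.\<close>

definition hom_ext :: "('a::euclidean_space \<Rightarrow> real) \<Rightarrow> 'a \<Rightarrow> real" where
  "hom_ext f v = norm v * f (unit_dir v)"

lemma hom_ext_scaleR: "0 \<le> c \<Longrightarrow> hom_ext f (c *\<^sub>R v) = c * hom_ext f v"
  by (cases "c = 0") (simp_all add: hom_ext_def unit_dir_def sgn_scaleR)

text \<open>Support functions are already homogeneous of degree one, so for them the integral
  against a discrete measure is a sum of values at the unnormalised vectors.\<close>

lemma hom_ext_support_fun:
  assumes "K \<in> convex_bodies"
  shows "hom_ext (support_fun K) v = support_fun K v"
proof (cases "v = 0")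
  case True
  then show ?thesis using support_fun_scaleR[OF assms, of 0 v] by (simp add: hom_ext_def)
next
  case False
  then have "support_fun K v = support_fun K (norm v *\<^sub>R sgn v)" by (simp add: sgn_div_norm)
  then show ?thesis
    using False support_fun_scaleR[OF assms] by (simp add: hom_ext_def unit_dir_def)
qed

text \<open>The extension is uniformly continuous on a compact shell around the sphere; the shell
  avoids the origin, where \<open>sgn\<close> is discontinuous.\<close>

lemma hom_ext_uniformly_close:
  fixes f :: "'a::euclidean_space \<Rightarrow> real"
  assumes f: "continuous_on (sphere 0 1) f" and "0 < e"
  obtains d where "0 < d" and
    "\<And>z y. norm z = 1 \<Longrightarrow> norm (y - z) \<le> d \<Longrightarrow> \<bar>hom_ext f y - f z\<bar> \<le> e"
proof -
  define S where "S = cball (0::'a) 2 - ball 0 (1/2)"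
  have S: "v \<in> S \<longleftrightarrow> 1/2 \<le> norm v \<and> norm v \<le> 2" for v
    by (auto simp: S_def)
  have "continuous_on S (\<lambda>v. norm v * f (sgn v))"
  proof (intro continuous_intros continuous_on_compose2[OF f])
    show "sgn ` S \<subseteq> sphere 0 1" by (force simp: S norm_sgn)
  qed (force simp: S)
  moreover have "norm v * f (sgn v) = hom_ext f v" if "v \<in> S" for v
    using that by (auto simp: hom_ext_def unit_dir_def S)
  ultimately have "continuous_on S (hom_ext f)" by (simp cong: continuous_on_cong)
  moreover have "compact S" by (simp add: S_def compact_diff)
  ultimately have "uniformly_continuous_on S (hom_ext f)"
    by (intro compact_uniformly_continuous)
  then obtain d where d: "0 < d"
    "\<And>z y. z \<in> S \<Longrightarrow> y \<in> S \<Longrightarrow> dist y z < d \<Longrightarrow> dist (hom_ext f y) (hom_ext f z) < e"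
    unfolding uniformly_continuous_on_def using \<open>0 < e\<close> by metis
  show ?thesis
  proof
    \<comment> \<open>Halving \<open>d\<close> turns a non-strict bound into a strict one, and
      \<open>1/2\<close> keeps \<open>y\<close> inside the shell.\<close>
    show "0 < min (d/2) (1/2)" using d by simp
    fix z y :: 'a assume zy: "norm z = 1" "norm (y - z) \<le> min (d/2) (1/2)"
    have "\<bar>norm y - norm z\<bar> \<le> norm (y - z)" by (rule norm_triangle_ineq3)
    then have "dist (hom_ext f y) (hom_ext f z) < e"
      using zy d(1) by (intro d(2)) (auto simp: S dist_norm)
    moreover have "hom_ext f z = f z"
      using zy by (auto simp: hom_ext_def unit_dir_def sgn_div_norm)
    ultimately show "\<bar>hom_ext f y - f z\<bar> \<le> e" by (simp add: dist_real_def)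
  qed
qed

text \<open>A push-forward from the index set, so that weights of indices with the same direction
  add up.\<close>

definition direction_measure :: "'i set \<Rightarrow> ('i \<Rightarrow> real ^ 'n) \<Rightarrow> (real ^ 'n) measure" where
  "direction_measure I v =
     distr (point_measure I (\<lambda>i. ennreal (norm (v i)))) sphere_borel (\<lambda>i. unit_dir (v i))"

lemma sets_direction_measure [simp]: "sets (direction_measure I v) = sets sphere_borel"
  by (simp add: direction_measure_def)

lemma finite_measure_direction_measure:
  assumes "finite I"
  shows "finite_measure (direction_measure I v)"
  unfolding direction_measure_def
proof (rule finite_measure.finite_measure_distr)
  show "finite_measure (point_measure I (\<lambda>i. ennreal (norm (v i))))"
    using assms by (intro finite_measureI) (simp add: space_point_measure emeasure_point_measure_finite)
qed simp

lemma integral_direction_measure: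
  fixes v :: "'i \<Rightarrow> real ^ 'n" and f :: "real ^ 'n \<Rightarrow> real"
  assumes "finite I" "continuous_on (sphere 0 1) f"
  shows "integral\<^sup>L (direction_measure I v) f = (\<Sum>i\<in>I. hom_ext f (v i))"
  using sphere_borel_measurable[OF assms(2)] assms(1)
  by (simp add: direction_measure_def integral_distr lebesgue_integral_point_measure_finite hom_ext_def)

lemma measure_direction_measure_eq_0:
  assumes "finite I" "A \<inter> (\<lambda>i. unit_dir (v i)) ` I = {}"
  shows "measure (direction_measure I v) A = 0"
proof (cases "A \<in> sets sphere_borel")
  case True
  have "(\<lambda>i. unit_dir (v i)) -` A \<inter> I = {}" using assms(2) by auto
  with True show ?thesis
    by (simp add: direction_measure_def measure_distr space_point_measure)
qed (simp add: measure_notin_sets)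

text \<open>Finite sets are closed, so \<open>A \<inter> P\<close> and the sphere without
  \<open>P - A\<close> squeeze \<open>A\<close>, and their difference misses \<open>P\<close>. Every
  point of the sphere off \<open>P\<close> has the complement of \<open>P\<close> as a null
  neighbourhood.\<close>

lemma regular_finite_support:
  assumes \<nu>: "signed_measure sphere_borel \<nu>" and P: "finite P"
    and null: "\<And>B. B \<inter> P = {} \<Longrightarrow> \<nu> B = 0"
  shows "regular_signed_measure \<nu>" "finite (measure_support \<nu>)"
proof -
  have "\<exists>F U. closedin (top_of_set (sphere 0 1)) F \<and> openin (top_of_set (sphere 0 1)) U \<and>
      F \<subseteq> A \<and> A \<subseteq> U \<and> (\<forall>B\<in>sets sphere_borel. B \<subseteq> U - F \<longrightarrow> \<bar>\<nu> B\<bar> < e)"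
    if A: "A \<in> sets sphere_borel" and "0 < e" for A and e :: real
  proof (intro exI conjI ballI impI)
    have sub: "A \<subseteq> sphere 0 1"
      using sets.sets_into_space[OF A] by simp
    show "closedin (top_of_set (sphere 0 1)) (A \<inter> P)"
      using sub P by (intro closed_subset finite_imp_closed) auto
    show "openin (top_of_set (sphere 0 1)) (sphere 0 1 - (P - A))"
      unfolding Diff_eq[of "sphere 0 1"]
      using P by (intro openin_open_Int open_Compl finite_imp_closed) simp
    show "A \<inter> P \<subseteq> A" "A \<subseteq> sphere 0 1 - (P - A)" using sub by auto
    fix B assume "B \<subseteq> sphere 0 1 - (P - A) - A \<inter> P"
    then have "B \<inter> P = {}" by blast
    then show "\<bar>\<nu> B\<bar> < e" using null \<open>0 < e\<close> by simp
  qed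
  then show "regular_signed_measure \<nu>"
    using \<nu> by (simp add: regular_signed_measure_def)
  have "measure_support \<nu> \<subseteq> P"
  proof
    fix x assume x: "x \<in> measure_support \<nu>"
    show "x \<in> P"
    proof (rule ccontr)
      assume "x \<notin> P"
      moreover have "x \<in> sphere 0 1" using x by (simp add: measure_support_def)
      ultimately have "x \<in> sphere 0 1 \<inter> - P" by blast
      moreover have "openin (top_of_set (sphere 0 1)) (sphere 0 1 \<inter> - P)"
        using P by (intro openin_open_Int open_Compl finite_imp_closed)
      ultimately obtain B where "B \<subseteq> sphere 0 1 \<inter> - P" "\<nu> B \<noteq> 0"
        using x unfolding measure_support_def mem_Collect_eq by meson
      moreover from this have "B \<inter> P = {}" by blast
      ultimately show False using null by simp
    qed
  qed
  then show "finite (measure_support \<nu>)" using P finite_subset by blast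
qed

subsection \<open>Barycentric partitions of unity\<close>

text \<open>The condition \<open>barycenter\<close> writes each point as a convex combination of
  nearby nodes, which is what sublinearity needs. The nodes may lie off \<open>S\<close>.\<close>

locale barycentric_partition =
  fixes S :: "'a::euclidean_space set" and d :: real
    and I :: "'i set" and w :: "'i \<Rightarrow> 'a \<Rightarrow> real" and q :: "'i \<Rightarrow> 'a"
  assumes finite_index: "finite I"
    and continuous_weight: "k \<in> I \<Longrightarrow> continuous_on S (w k)"
    and weight_nonneg: "k \<in> I \<Longrightarrow> z \<in> S \<Longrightarrow> 0 \<le> w k z"
    and weight_local: "k \<in> I \<Longrightarrow> z \<in> S \<Longrightarrow> w k z \<noteq> 0 \<Longrightarrow> norm (z - q k) \<le> d"
    and sum_weight: "z \<in> S \<Longrightarrow> (\<Sum>k\<in>I. w k z) = 1"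
    and barycenter: "z \<in> S \<Longrightarrow> (\<Sum>k\<in>I. w k z *\<^sub>R q k) = z"

text \<open>A partition of unity subordinate to small balls is refined by spreading each point of a ball
  with centre c over the vertices of a cross-polytope around c, with weights affine in the point.\<close>

lemma barycentric_partition_exists:
  fixes S :: "'a::euclidean_space set"
  assumes S: "compact S" and d: "0 < d"
  shows "\<exists>(I :: ('a \<times> 'a \<times> real) set) w q. barycentric_partition S d I w q"
proof -
  define N where "N = real DIM('a)"
  \<comment> \<open>\<open>e\<close> is the distance from a centre to its vertices and
    \<open>r\<close> the radius of the balls. The factor \<open>1 / N\<close> makes the weights
    nonnegative on a ball, and \<open>r + e \<le> d\<close> makes them local.\<close>
  define e where "e = d / 2"
  define r where "r = e / N"
  have N: "1 \<le> N" by (simp add: N_def Suc_leI DIM_positive)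
  have pos: "0 < e" "0 < r" "r \<le> e" using d N by (auto simp: e_def r_def field_simps)
  obtain C where C: "C \<subseteq> S" "finite C" "S \<subseteq> (\<Union>c\<in>C. ball c r)"
    using compactE_image[OF S, of S "\<lambda>c. ball c r"] pos by force
  \<comment> \<open>Tent functions on the covering balls; their sum is positive on \<open>S\<close>,
    so normalising them gives a partition of unity.\<close>
  define \<phi> where "\<phi> c z = max 0 (r - dist z c)" for c z :: 'a
  define \<Phi> where "\<Phi> z = (\<Sum>c\<in>C. \<phi> c z)" for z
  have \<phi>_nonneg: "0 \<le> \<phi> c z" for c z by (simp add: \<phi>_def)
  have \<Phi>_pos: "0 < \<Phi> z" if z: "z \<in> S" for z
  proof -
    obtain c where "c \<in> C" "dist c z < r" using C(3) z by auto
    then show ?thesis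
      unfolding \<Phi>_def using C(2) \<phi>_nonneg
      by (intro sum_pos2[of C c]) (auto simp: \<phi>_def dist_commute)
  qed
  define p where "p c z = \<phi> c z / \<Phi> z" for c z
  have p_nonneg: "0 \<le> p c z" if "z \<in> S" for c z
    using \<phi>_nonneg \<Phi>_pos[OF that] by (simp add: p_def)
  have p_sum: "(\<Sum>c\<in>C. p c z) = 1" if "z \<in> S" for z
    using \<Phi>_pos[OF that] by (simp add: p_def sum_divide_distrib[symmetric] \<Phi>_def)
  have p_local: "norm (z - c) < r" if "p c z \<noteq> 0" for c z
    using that by (auto simp: p_def \<phi>_def max_def dist_norm split: if_splits)
  have p_cont: "continuous_on S (p c)" for c
    using \<Phi>_pos unfolding p_def[abs_def] \<Phi>_def \<phi>_def
    by (intro continuous_intros) (auto simp: less_imp_neq[symmetric])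
  define I where "I = C \<times> (Basis :: 'a set) \<times> {1, - 1 :: real}"
  \<comment> \<open>The factors of the opposite vertices \<open>c + e b\<close> and
    \<open>c - e b\<close> add up to \<open>1 / N\<close> and differ by
    \<open>((z - c) \<bullet> b) / e\<close>, so the pair contributes \<open>c / N\<close> plus the
    \<open>b\<close>-component of \<open>z - c\<close>.\<close>
  define w where
    "w = (\<lambda>(c, b, s) z. p c z * (1 / (2 * N) + s * ((z - c) \<bullet> b) / (2 * e)))"
  define q where "q = (\<lambda>(c, b, s). c + (s * e) *\<^sub>R (b::'a))"
  have sum_I: "(\<Sum>k\<in>I. g k) = (\<Sum>c\<in>C. \<Sum>b\<in>Basis. g (c, b, 1) + g (c, b, - 1))"
    for g :: "'a \<times> 'a \<times> real \<Rightarrow> 'b::comm_monoid_add"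
  proof -
    have "(\<Sum>k\<in>I. g k) = (\<Sum>c\<in>C. \<Sum>b\<in>Basis. \<Sum>s\<in>{1, - 1}. g (c, b, s))"
      unfolding I_def by (simp only: sum.cartesian_product split_def prod.collapse)
    then show ?thesis by simp
  qed
  have "barycentric_partition S d I w q"
  proof
    show "finite I" using C(2) by (simp add: I_def)
  next
    fix k assume "k \<in> I"
    then show "continuous_on S (w k)"
      using pos unfolding w_def by (cases k) (auto intro!: continuous_intros p_cont)
  next
    fix k z assume k: "k \<in> I" and z: "z \<in> S"
    obtain c b s where kdef: "k = (c, b, s)" by (cases k) auto
    have s: "s = 1 \<or> s = - 1" and b: "b \<in> Basis" using k by (auto simp: I_def kdef)
    show "0 \<le> w k z"
    proof (cases "p c z = 0")
      case False
      have "\<bar>(z - c) \<bullet> b\<bar> \<le> r"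
        using Basis_le_norm[OF b, of "z - c"] p_local[OF False] by simp
      then have "\<bar>(z - c) \<bullet> b\<bar> / (2 * e) \<le> r / (2 * e)"
        using pos by (intro divide_right_mono) auto
      also have "\<dots> = 1 / (2 * N)" using pos by (simp add: r_def)
      finally have "\<bar>s * ((z - c) \<bullet> b) / (2 * e)\<bar> \<le> 1 / (2 * N)"
        using s pos by (auto simp: abs_mult)
      then show ?thesis
        using p_nonneg[OF z] by (simp add: w_def kdef abs_le_iff del: abs_divide)
    qed (simp add: w_def kdef)
    assume "w k z \<noteq> 0"
    then have "norm (z - c) < r" by (intro p_local) (auto simp: w_def kdef)
    moreover have "norm ((s * e) *\<^sub>R b) = e" using s b pos by auto
    moreover have "norm (z - q k) \<le> norm (z - c) + norm ((s * e) *\<^sub>R b)"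
      using norm_triangle_ineq4[of "z - c" "(s * e) *\<^sub>R b"] by (simp add: q_def kdef diff_diff_eq)
    ultimately show "norm (z - q k) \<le> d" using pos by (simp add: e_def)
  next
    fix z assume z: "z \<in> S"
    have "(\<Sum>k\<in>I. w k z) = (\<Sum>c\<in>C. \<Sum>b\<in>(Basis :: 'a set). p c z / N)"
      unfolding sum_I using N by (intro sum.cong refl) (simp add: w_def field_simps)
    also have "\<dots> = 1" using p_sum[OF z] N by (simp add: N_def)
    finally show "(\<Sum>k\<in>I. w k z) = 1" .
    have "w (c, b, 1) z *\<^sub>R q (c, b, 1) + w (c, b, - 1) z *\<^sub>R q (c, b, - 1)
        = p c z *\<^sub>R ((1 / N) *\<^sub>R c + ((z - c) \<bullet> b) *\<^sub>R b)" for c b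
    proof -
      define t where "t = ((z - c) \<bullet> b) / (2 * e)"
      have w: "w (c, b, 1) z = p c z * (1 / (2 * N) + t)" "w (c, b, - 1) z = p c z * (1 / (2 * N) - t)"
        by (simp_all add: w_def t_def)
      have "w (c, b, 1) z *\<^sub>R q (c, b, 1) + w (c, b, - 1) z *\<^sub>R q (c, b, - 1)
          = (w (c, b, 1) z + w (c, b, - 1) z) *\<^sub>R c + ((w (c, b, 1) z - w (c, b, - 1) z) * e) *\<^sub>R b"
        by (simp add: q_def algebra_simps)
      moreover have "w (c, b, 1) z + w (c, b, - 1) z = p c z * (1 / N)"
        using N by (simp add: w field_simps)
      moreover have "(w (c, b, 1) z - w (c, b, - 1) z) * e = p c z * ((z - c) \<bullet> b)"
        using pos unfolding w t_def by (simp add: field_simps del: inner_diff_left)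
      ultimately show ?thesis by (simp add: scaleR_add_right)
    qed
    then have "(\<Sum>k\<in>I. w k z *\<^sub>R q k)
        = (\<Sum>c\<in>C. p c z *\<^sub>R (\<Sum>b\<in>Basis. (1 / N) *\<^sub>R c + ((z - c) \<bullet> b) *\<^sub>R b))"
      unfolding sum_I by (simp add: scaleR_sum_right)
    \<comment> \<open>Over the basis, the \<open>N\<close> copies of \<open>c / N\<close> sum to
      \<open>c\<close> and the components of \<open>z - c\<close> sum to
      \<open>z - c\<close>.\<close>
    also have "\<dots> = (\<Sum>c\<in>C. p c z *\<^sub>R z)"
      using N by (intro sum.cong refl)
        (simp add: sum.distrib euclidean_representation sum_constant_scaleR N_def del: scaleR_diff_left inner_diff_left)
    also have "\<dots> = z" using p_sum[OF z] by (simp add: scaleR_sum_left[symmetric])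
    finally show "(\<Sum>k\<in>I. w k z *\<^sub>R q k) = z" .
  qed
  then show ?thesis by blast
qed

subsection \<open>Discretisation of positive measures\<close>

text \<open>\<open>M\<close> stands for either Jordan part. The vectors
  \<open>mass k *\<^sub>R q k\<close> serve the positive part and \<open>moment k\<close> the
  negative one.\<close>

locale sphere_discretisation = barycentric_partition "sphere (0 :: real ^ 'n) 1" d I w q
  for d and I :: "'i set" and w q +
  fixes M :: "(real ^ 'n) measure"
  assumes finite_measure_M: "finite_measure M" and sets_M: "sets M = sets sphere_borel"
begin

definition mass :: "'i \<Rightarrow> real" where
  "mass k = (\<integral>z. w k z \<partial>M)"

text \<open>The unnormalised barycentre of the measure with density \<open>w k\<close>; cells of
  mass 0 thus require no division.\<close>

definition moment :: "'i \<Rightarrow> real ^ 'n" where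
  "moment k = (\<integral>z. w k z *\<^sub>R z \<partial>M)"

lemma space_M: "space M = sphere 0 1"
  using sets_eq_imp_space_eq[OF sets_M] by simp

lemma integrable_continuous:
  fixes f :: "real ^ 'n \<Rightarrow> 'b::{banach, second_countable_topology}"
  shows "continuous_on (sphere 0 1) f \<Longrightarrow> integrable M f"
  by (rule integrable_continuous_on_sphere[OF finite_measure_M sets_M])

lemma integrable_weight_scaleR:
  fixes f :: "real ^ 'n \<Rightarrow> 'b::{banach, second_countable_topology}"
  assumes "k \<in> I" "continuous_on (sphere 0 1) f"
  shows "integrable M (\<lambda>z. w k z *\<^sub>R f z)"
  using assms by (intro integrable_continuous continuous_on_scaleR continuous_weight)

lemma integrable_weight: "k \<in> I \<Longrightarrow> integrable M (w k)"
  by (intro integrable_continuous continuous_weight)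

lemma mass_nonneg: "k \<in> I \<Longrightarrow> 0 \<le> mass k"
  unfolding mass_def by (intro integral_nonneg_AE AE_I2) (simp add: weight_nonneg space_M)

lemma sum_mass: "(\<Sum>k\<in>I. mass k) = measure M (space M)"
proof -
  have "(\<Sum>k\<in>I. mass k) = (\<integral>z. (\<Sum>k\<in>I. w k z) \<partial>M)"
    unfolding mass_def by (simp add: integrable_weight)
  also have "\<dots> = (\<integral>z. 1 \<partial>M)"
    using sum_weight by (intro Bochner_Integration.integral_cong) (simp_all add: space_M)
  finally show ?thesis by simp
qed

lemma integral_eq_sum_weight:
  assumes "continuous_on (sphere 0 1) f"
  shows "(\<integral>z. f z \<partial>M) = (\<Sum>k\<in>I. \<integral>z. w k z * f z \<partial>M)"
proof -
  have "(\<Sum>k\<in>I. \<integral>z. w k z * f z \<partial>M) = (\<integral>z. (\<Sum>k\<in>I. w k z * f z) \<partial>M)"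
    using integrable_weight_scaleR[OF _ assms] by simp
  also have "\<dots> = (\<integral>z. f z \<partial>M)"
    using sum_weight
    by (intro Bochner_Integration.integral_cong) (simp_all add: space_M sum_distrib_right[symmetric])
  finally show ?thesis by simp
qed

text \<open>The weight \<open>w k\<close> vanishes at points of the sphere farther than
  \<open>d\<close> from \<open>q k\<close>. This makes the moments admissible vectors in
  \<open>discretisation_error\<close>.\<close>

lemma norm_moment_diff_le:
  assumes k: "k \<in> I"
  shows "norm (moment k - mass k *\<^sub>R q k) \<le> mass k * d"
proof -
  have "moment k - mass k *\<^sub>R q k = (\<integral>z. w k z *\<^sub>R (z - q k) \<partial>M)"
    unfolding moment_def mass_def scaleR_diff_right
    using k by (subst Bochner_Integration.integral_diff)
      (auto intro!: integrable_weight_scaleR continuous_intros simp: integrable_weight)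
  also have "norm \<dots> \<le> (\<integral>z. norm (w k z *\<^sub>R (z - q k)) \<partial>M)"
    by (rule integral_norm_bound)
  also have "\<dots> \<le> (\<integral>z. w k z * d \<partial>M)"
  proof (rule integral_mono)
    show "integrable M (\<lambda>z. norm (w k z *\<^sub>R (z - q k)))"
      using k by (intro integrable_norm integrable_weight_scaleR continuous_intros)
    show "integrable M (\<lambda>z. w k z * d)" using k by (simp add: integrable_weight)
    fix z assume "z \<in> space M"
    then show "norm (w k z *\<^sub>R (z - q k)) \<le> w k z * d"
      using weight_nonneg[OF k, of z] weight_local[OF k, of z]
      by (cases "w k z = 0") (auto simp: space_M intro: mult_left_mono)
  qed
  finally show ?thesis by (simp add: mass_def)
qed

text \<open>Write \<open>v k\<close> as \<open>mass k *\<^sub>R y\<close> with \<open>y\<close> near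
  \<open>q k\<close>. Wherever \<open>w k\<close> is nonzero, \<open>z\<close> is also near
  \<open>q k\<close>, so \<open>y\<close> and \<open>z\<close> are at most \<open>2 * d\<close>
  apart. The cell then costs at most \<open>mass k * e\<close>, and the masses add up to the total
  mass.\<close>

lemma discretisation_error:
  assumes f: "continuous_on (sphere 0 1) f"
    and v: "\<And>k. k \<in> I \<Longrightarrow> norm (v k - mass k *\<^sub>R q k) \<le> mass k * d"
    and close: "\<And>z y. norm z = 1 \<Longrightarrow> norm (y - z) \<le> 2 * d \<Longrightarrow> \<bar>hom_ext f y - f z\<bar> \<le> e"
  shows "\<bar>(\<Sum>k\<in>I. hom_ext f (v k)) - (\<integral>z. f z \<partial>M)\<bar> \<le> e * measure M (space M)"
proof -
  have *: "\<bar>hom_ext f (v k) - (\<integral>z. w k z * f z \<partial>M)\<bar> \<le> mass k * e" if k: "k \<in> I" for k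
  proof -
    \<comment> \<open>In a cell of mass 0 the vector \<open>v k\<close> is 0 and
      \<open>y = q k\<close> will do. This case is listed separately because \<open>d\<close>
      carries no sign assumption here; a nonzero weight later forces
      \<open>0 \<le> d\<close>.\<close>
    have "\<exists>y. v k = mass k *\<^sub>R y \<and> (norm (y - q k) \<le> d \<or> y = q k)"
    proof (cases "mass k = 0")
      case True
      then show ?thesis using v[OF k] by auto
    next
      case False
      define y where "y = v k /\<^sub>R mass k"
      have vy: "v k = mass k *\<^sub>R y" using False by (simp add: y_def)
      have "mass k * norm (y - q k) \<le> mass k * d"
        using v[OF k] mass_nonneg[OF k] by (simp add: vy scaleR_diff_right[symmetric] del: scaleR_diff_right)
      then show ?thesis using vy False mass_nonneg[OF k] by auto
    qed
    then obtain y where y: "v k = mass k *\<^sub>R y" "norm (y - q k) \<le> d \<or> y = q k" by auto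
    have int: "integrable M (\<lambda>z. w k z * (hom_ext f y - f z))"
      using integrable_weight_scaleR[OF k, of "\<lambda>z. hom_ext f y - f z"] f
      by (simp add: continuous_intros)
    have "hom_ext f (v k) - (\<integral>z. w k z * f z \<partial>M) = (\<integral>z. w k z * (hom_ext f y - f z) \<partial>M)"
      using integrable_weight[OF k] integrable_weight_scaleR[OF k f] mass_nonneg[OF k]
      by (simp add: y hom_ext_scaleR right_diff_distrib mass_def)
    also have "\<bar>\<dots>\<bar> \<le> (\<integral>z. \<bar>w k z * (hom_ext f y - f z)\<bar> \<partial>M)"
      by (rule integral_abs_bound)
    also have "\<dots> \<le> (\<integral>z. w k z * e \<partial>M)"
    proof (rule integral_mono)
      show "integrable M (\<lambda>z. \<bar>w k z * (hom_ext f y - f z)\<bar>)" using int by (rule integrable_abs)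
      show "integrable M (\<lambda>z. w k z * e)" using k by (simp add: integrable_weight)
      fix z assume z: "z \<in> space M"
      show "\<bar>w k z * (hom_ext f y - f z)\<bar> \<le> w k z * e"
      proof (cases "w k z = 0")
        case False
        then have "norm (z - q k) \<le> d" using weight_local k z by (simp add: space_M)
        moreover have "norm (y - z) \<le> norm (y - q k) + norm (z - q k)"
          using norm_triangle_ineq4[of "y - q k" "z - q k"] by simp
        moreover have "0 \<le> norm (z - q k)" by simp
        ultimately have "norm (y - z) \<le> 2 * d" using y(2) by (auto simp del: norm_ge_zero)
        then show ?thesis
          using close[of z y] z weight_nonneg[OF k, of z] by (simp add: space_M abs_mult mult_left_mono)
      qed simp
    qed
    finally show ?thesis by (simp add: mass_def)
  qed
  have "\<bar>(\<Sum>k\<in>I. hom_ext f (v k)) - (\<integral>z. f z \<partial>M)\<bar>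
      = \<bar>\<Sum>k\<in>I. hom_ext f (v k) - (\<integral>z. w k z * f z \<partial>M)\<bar>"
    by (simp add: integral_eq_sum_weight[OF f] sum_subtractf)
  also have "\<dots> \<le> (\<Sum>k\<in>I. mass k * e)"
    using * by (rule sum_abs[THEN order_trans, OF sum_mono])
  also have "\<dots> = e * measure M (space M)"
    by (simp add: sum_mass[symmetric] sum_distrib_left mult.commute)
  finally show ?thesis .
qed

text \<open>Integrate the sublinear bound at \<open>z\<close>, written as the barycentre of the
  nodes.\<close>

lemma integral_support_fun_le_sum_nodes:
  assumes K: "K \<in> convex_bodies"
  shows "(\<integral>z. support_fun K z \<partial>M) \<le> (\<Sum>k\<in>I. support_fun K (mass k *\<^sub>R q k))"
proof -
  have "(\<integral>z. support_fun K z \<partial>M) \<le> (\<integral>z. (\<Sum>k\<in>I. w k z * support_fun K (q k)) \<partial>M)"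
  proof (rule integral_mono)
    show "integrable M (support_fun K)"
      by (intro integrable_continuous continuous_on_support_fun K)
    show "integrable M (\<lambda>z. \<Sum>k\<in>I. w k z * support_fun K (q k))"
      by (simp add: integrable_weight)
    fix z assume z: "z \<in> space M"
    then show "support_fun K z \<le> (\<Sum>k\<in>I. w k z * support_fun K (q k))"
      using support_fun_sum_le[OF K, of I "\<lambda>k. w k z" q] barycenter[of z] weight_nonneg
      by (simp add: space_M)
  qed
  also have "\<dots> = (\<Sum>k\<in>I. support_fun K (mass k *\<^sub>R q k))"
    by (simp add: integrable_weight mass_def[symmetric] support_fun_scaleR[OF K] mass_nonneg)
  finally show ?thesis .
qed

text \<open>Jensen's inequality in each cell: \<open>x \<bullet> moment k\<close> is the integral of
  \<open>w k z * (x \<bullet> z)\<close>, and \<open>x \<bullet> z\<close> is at most the support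
  function for every \<open>x \<in> K\<close>.\<close>

lemma sum_moments_le_integral_support_fun:
  assumes K: "K \<in> convex_bodies"
  shows "(\<Sum>k\<in>I. support_fun K (moment k)) \<le> (\<integral>z. support_fun K z \<partial>M)"
proof -
  note h = continuous_on_support_fun[OF K]
  have "support_fun K (moment k) \<le> (\<integral>z. w k z * support_fun K z \<partial>M)" if k: "k \<in> I" for k
  proof (rule support_fun_le[OF K])
    fix x assume x: "x \<in> K"
    have int: "integrable M (\<lambda>z. w k z *\<^sub>R z)"
      using k by (intro integrable_weight_scaleR continuous_intros)
    then have "x \<bullet> moment k = (\<integral>z. x \<bullet> (w k z *\<^sub>R z) \<partial>M)"
      unfolding moment_def by (intro integral_inner_right[symmetric])
    also have "\<dots> \<le> (\<integral>z. w k z * support_fun K z \<partial>M)"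
    proof (rule integral_mono)
      show "integrable M (\<lambda>z. x \<bullet> (w k z *\<^sub>R z))" using int by (rule integrable_inner_right)
      show "integrable M (\<lambda>z. w k z * support_fun K z)"
        using integrable_weight_scaleR[OF k h] by simp
      fix z assume "z \<in> space M"
      then show "x \<bullet> (w k z *\<^sub>R z) \<le> w k z * support_fun K z"
        using weight_nonneg[OF k, of z] inner_le_support_fun[OF K x, of z]
        by (simp add: space_M mult_left_mono)
    qed
    finally show "x \<bullet> moment k \<le> (\<integral>z. w k z * support_fun K z \<partial>M)" .
  qed
  then show ?thesis
    unfolding integral_eq_sum_weight[OF h] by (rule sum_mono)
qed

end

section \<open>Assembly of the discrete signed measures and their weak* convergence\<close>

theorem mainTheorem6:
  fixes H :: "(real ^ 'n) set set" and \<mu> :: "(real ^ 'n) set \<Rightarrow> real"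
  assumes "subcone H"
    and "\<mu> \<in> dual_cone H"
  shows "\<exists>\<nu> :: nat \<Rightarrow> (real ^ 'n) set \<Rightarrow> real.
           (\<forall>m. \<nu> m \<in> dual_cone H \<and> finite (measure_support (\<nu> m))) \<and>
           weak_star_converges \<nu> \<mu>"
proof -
  let ?S = "sphere (0 :: real ^ 'n) 1"
  define U V where "U = upper_variation sphere_borel \<mu>"
    and "V = upper_variation sphere_borel (\<lambda>A. - \<mu> A)"
  have \<mu>: "signed_measure sphere_borel \<mu>"
    using assms(2) by (simp add: dual_cone_def regular_signed_measure_def)
  have U: "finite_measure U" "sets U = sets sphere_borel"
    and V: "finite_measure V" "sets V = sets sphere_borel"
    unfolding U_def V_def by (simp_all add: finite_measure_upper_variation \<mu> signed_measure_uminus)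
  define d where "d m = 1 / real (Suc m)" for m
  have "\<exists>I w q. barycentric_partition ?S (d m) (I :: ((real ^ 'n) \<times> (real ^ 'n) \<times> real) set) w q" for m
    using barycentric_partition_exists[OF compact_sphere, of "d m" 0 1] by (simp add: d_def)
  then obtain I w q where part: "\<And>m. barycentric_partition ?S (d m)
      (I m :: ((real ^ 'n) \<times> (real ^ 'n) \<times> real) set) (w m) (q m)"
    by metis
  have fin: "finite (I m)" for m using barycentric_partition.finite_index[OF part] .
  have disc: "sphere_discretisation (d m) (I m) (w m) (q m) M"
    if "finite_measure M" "sets M = sets sphere_borel" for m M
    using part that by (simp add: sphere_discretisation_def sphere_discretisation_axioms_def)
  define a b where "a m k = sphere_discretisation.mass (w m) U k *\<^sub>R q m k"
    and "b m k = sphere_discretisation.moment (w m) V k" for m k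
  define \<nu> where "\<nu> m A = measure (direction_measure (I m) (a m)) A
      - measure (direction_measure (I m) (b m)) A" for m A
  have signed: "signed_measure sphere_borel (\<nu> m)" for m
    unfolding \<nu>_def[abs_def]
    by (intro signed_measure_measure_diff finite_measure_direction_measure fin) simp_all
  have integral: "signed_integral sphere_borel (\<nu> m) f
      = (\<Sum>k\<in>I m. hom_ext f (a m k)) - (\<Sum>k\<in>I m. hom_ext f (b m k))"
    if "continuous_on ?S f" for m f
    unfolding \<nu>_def[abs_def] using that fin
    by (simp add: signed_integral_continuous finite_measure_direction_measure integral_direction_measure)
  have "\<nu> m \<in> dual_cone H \<and> finite (measure_support (\<nu> m))" for m
  proof -
    let ?P = "(\<lambda>k. unit_dir (a m k)) ` I m \<union> (\<lambda>k. unit_dir (b m k)) ` I m"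
    have "\<nu> m B = 0" if "B \<inter> ?P = {}" for B
      unfolding \<nu>_def using that fin by (subst (1 2) measure_direction_measure_eq_0) auto
    note regular = regular_finite_support[OF signed _ this, of ?P]
    have "0 \<le> signed_integral sphere_borel (\<nu> m) (support_fun K)" if "K \<in> H" for K
    proof -
      have K: "K \<in> convex_bodies" using assms(1) that by (auto simp: subcone_def)
      have "0 \<le> signed_integral sphere_borel \<mu> (support_fun K)"
        using assms(2) that by (simp add: dual_cone_def)
      also have "\<dots> = (\<integral>z. support_fun K z \<partial>U) - (\<integral>z. support_fun K z \<partial>V)"
        by (simp add: signed_integral_def U_def V_def)
      \<comment> \<open>Both replacements push the difference upwards: the \<open>U\<close> term
        grows and the subtracted \<open>V\<close> term shrinks.\<close>
      also have "\<dots> \<le> (\<Sum>k\<in>I m. support_fun K (a m k)) - (\<Sum>k\<in>I m. support_fun K (b m k))"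
        unfolding a_def b_def
        by (intro diff_mono
            sphere_discretisation.integral_support_fun_le_sum_nodes[OF disc[OF U] K]
            sphere_discretisation.sum_moments_le_integral_support_fun[OF disc[OF V] K])
      finally show ?thesis
        using K by (simp add: integral continuous_on_support_fun hom_ext_support_fun)
    qed
    then show ?thesis using regular fin by (simp add: dual_cone_def)
  qed
  moreover have "weak_star_converges \<nu> \<mu>"
    unfolding weak_star_converges_def
  proof (intro allI impI)
    fix f :: "real ^ 'n \<Rightarrow> real" assume f: "continuous_on ?S f"
    \<comment> \<open>The added 1 keeps \<open>T\<close> positive when \<open>\<mu>\<close> is zero,
      and makes the total error \<open>e / T * (T - 1)\<close> strictly smaller than
      \<open>e\<close>.\<close>
    define T where "T = measure U (space U) + measure V (space V) + 1"
    have T: "0 < T" by (simp add: T_def add_nonneg_pos)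
    show "(\<lambda>m. signed_integral sphere_borel (\<nu> m) f) \<longlonglongrightarrow> signed_integral sphere_borel \<mu> f"
    proof (rule LIMSEQ_I)
      fix e :: real assume "0 < e"
      then obtain \<delta> where \<delta>: "0 < \<delta>"
        "\<And>z y. norm z = 1 \<Longrightarrow> norm (y - z) \<le> \<delta> \<Longrightarrow> \<bar>hom_ext f y - f z\<bar> \<le> e / T"
        using hom_ext_uniformly_close[OF f, of "e / T"] T by (metis divide_pos_pos)
      \<comment> \<open>Half of \<open>\<delta>\<close>, because \<open>discretisation_error\<close>
        compares points up to \<open>2 * d m\<close> apart.\<close>
      obtain n where n: "d n < \<delta> / 2"
        using reals_Archimedean[of "\<delta> / 2"] \<delta>(1) by (auto simp: d_def inverse_eq_divide)
      have "norm (signed_integral sphere_borel (\<nu> m) f - signed_integral sphere_borel \<mu> f) < e"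
        if "n \<le> m" for m
      proof -
        have "d m \<le> d n" using that by (simp add: d_def frac_le)
        then have close: "\<bar>hom_ext f y - f z\<bar> \<le> e / T"
          if "norm z = 1" "norm (y - z) \<le> 2 * d m" for z y
          using that n by (intro \<delta>(2)) auto
        interpret U: sphere_discretisation "d m" "I m" "w m" "q m" U by (rule disc[OF U])
        interpret V: sphere_discretisation "d m" "I m" "w m" "q m" V by (rule disc[OF V])
        \<comment> \<open>The vectors \<open>a m k\<close> have deviation 0 from
          \<open>mass k *\<^sub>R q k\<close>, which is within the allowed
          \<open>mass k * d m\<close> once \<open>d m\<close> is nonnegative.\<close>
        have "0 \<le> d m" by (simp add: d_def)
        then have "\<bar>(\<Sum>k\<in>I m. hom_ext f (a m k)) - (\<integral>z. f z \<partial>U)\<bar> \<le> e / T * measure U (space U)"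
          by (intro U.discretisation_error f close) (simp add: a_def U.mass_nonneg)
        moreover have "\<bar>(\<Sum>k\<in>I m. hom_ext f (b m k)) - (\<integral>z. f z \<partial>V)\<bar> \<le> e / T * measure V (space V)"
          by (intro V.discretisation_error f close) (simp add: b_def V.norm_moment_diff_le)
        moreover have "e / T * measure U (space U) + e / T * measure V (space V) = e / T * (T - 1)"
          by (simp add: T_def distrib_left)
        moreover have "e / T * (T - 1) = e - e / T"
          using T by (simp add: right_diff_distrib)
        moreover have "0 < e / T" using \<open>0 < e\<close> T by simp
        moreover have "signed_integral sphere_borel \<mu> f = (\<integral>z. f z \<partial>U) - (\<integral>z. f z \<partial>V)"
          by (simp add: signed_integral_def U_def V_def)
        ultimately show ?thesis
          unfolding integral[OF f] real_norm_def by linarith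
      qed
      then show "\<exists>n. \<forall>m\<ge>n. norm (signed_integral sphere_borel (\<nu> m) f
          - signed_integral sphere_borel \<mu> f) < e" by blast
    qed
  qed
  ultimately show ?thesis by blast
qed

end
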